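(* Let $\mathcal{C}$ be a combinatorial class with a decomposition rule $\langle\cdot\rangle:\mathcal{C}\to\mathrm{MSet}(\mathcal{C}\times\mathcal{C})$, let $\mathbb{K}$ be a field, and let $\mathscr{C}=\mathbb{K}\,\mathcal{C}$ be the $\mathbb{K}$-vector space of finite linear combinations of elements of $\mathcal{C}$ (with basis $\mathcal{C}$). Suppose that: (i) (Finiteness) for every $\Gamma\in\mathcal{C}$ the multiset $\langle\Gamma\rangle$ is finite; (ii) (Triple decomposition) for every $\Gamma\in\mathcal{C}$ the following equality of multisets of triples holds: $$\biguplus_{(\Gamma'',\Gamma')\in\langle\Gamma\rangle}\{\Gamma''\}\times\langle\Gamma'\rangle=\biguplus_{(\Gamma'',\Gamma')\in\langle\Gamma\rangle}\langle\Gamma''\rangle\times\{\Gamma'\};$$ (iii) (Void object) there is an object $\text{\O}\in\mathcal{C}$ such that $\langle\text{\O}\rangle=\{(\text{\O},\text{\O})\}$ and, for every $\Gamma\neq\text{\O}$, the pairs in the multiset $\langle\Gamma\rangle$ having a component equal to $\text{\O}$ or to $\Gamma$ are exactly the two pairs $(\text{\O},\Gamma)$ and $(\Gamma,\text{\O})$, each occurring with multiplicity one. Define linear maps $\Delta:\mathscr{C}\to\mathscr{C}\otimes\mathscr{C}$ and $\varepsilon:\mathscr{C}\to\mathbb{K}$ on basis elements $\Gamma\in\mathcal{C}$ by $$\Delta(\Gamma)=\sum_{(\Gamma'',\Gamma')\in\langle\Gamma\rangle}\Gamma''\otimes\Gamma',\qquad \varepsilon(\Gamma)=\begin{cases}1&\text{if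 }\Gamma=\text{\O},\\0&\text{otherwise}\end{cases}$$ (the sum being over the multiset, i.e. counted with multiplicity). Then $\Delta$ and $\varepsilon$ are a co-multiplication and a co-unit making $\mathscr{C}$ into a (co-associative, co-unital) co-algebra $(\mathscr{C},+,\Delta,\varepsilon)$. If moreover, for every $\Gamma\in\mathcal{C}$, one has $(\Gamma',\Gamma'')\in\langle\Gamma\rangle\Leftrightarrow(\Gamma'',\Gamma')\in\langle\Gamma\rangle$ with equal multiplicities, then this co-algebra is co-commutative.
   Context: A multiset is a pair $(A,m)$ with $A$ a set and $m:A\to\mathbb{N}_{\geq 1}$ a multiplicity function; equality of multisets means equality of underlying sets and of multiplicities. The sum $\uplus$ of multisets adds multiplicities, and the product $A\times B$ has multiplicities $m_{A\times B}((a,b))=m_A(a)\,m_B(b)$. Sums and unions indexed by multisets count elements with multiplicity. A combinatorial class $\mathcal{C}$ is a denumerable collection of objects. $\mathrm{MSet}(X)$ denotes the class of multisets of elements of $X$. A decomposition rule is a mapping $\langle\cdot\rangle:\mathcal{C}\to\mathrm{MSet}(\mathcal{C}\times\mathcal{C})$ assigning to $\Gamma$ the multiset of all ordered pairs $(\Gamma'',\Gamma')$ into which $\Gamma$ splits. The usual identifications $(\mathcal{C}\times\mathcal{C})\times\mathcal{C}=\mathcal{C}\times(\mathcal{C}\times\mathcal{C})=\mathcal{C}^3$ and $\mathbb{K}\otimes\mathscr{C}=\mathscr{C}=\mathscr{C}\otimes\mathbb{K}$ are used. *)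

theory Defs
  imports Complex_Main "HOL-Library.Poly_Mapping" "HOL-Library.Countable"
begin

section \<open>Multisets with possibly infinite support\<close>

text \<open>
  A multiset is encoded by its multiplicity function, extended by \<open>0\<close> outside the underlying set;
  so equality of functions is equality of underlying sets and of multiplicities.  The type
  \<open>multiset\<close> of the library is not used because it contains finite multisets only, whereas
  finiteness is a hypothesis on a decomposition rule.
\<close>

type_synonym 'a mset_fun = "'a \<Rightarrow> nat"

definition msupport :: "'a mset_fun \<Rightarrow> 'a set" where
  "msupport M = {x. 0 < M x}"

definition mfinite :: "'a mset_fun \<Rightarrow> bool" where
  "mfinite M \<longleftrightarrow> finite (msupport M)"

definition msingleton :: "'a \<Rightarrow> 'a mset_fun" where
  "msingleton x = (\<lambda>y. if y = x then 1 else 0)"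

definition mtimes :: "'a mset_fun \<Rightarrow> 'b mset_fun \<Rightarrow> ('a \<times> 'b) mset_fun" where
  "mtimes M N = (\<lambda>(a, b). M a * N b)"

text \<open>
  Sum of a family of multisets over an index multiset, each index being counted with its
  multiplicity.  This is meaningful for a finite index multiset only (\<open>sum\<close> over an infinite set
  is \<open>0\<close>).
\<close>

definition msum :: "'i mset_fun \<Rightarrow> ('i \<Rightarrow> 'a mset_fun) \<Rightarrow> 'a mset_fun" where
  "msum I F = (\<lambda>x. \<Sum>i\<in>msupport I. I i * F i x)"

text \<open>The identification of $(A \times B) \times C$ with $A \times (B \times C)$.\<close>

definition massoc :: "(('a \<times> 'b) \<times> 'c) mset_fun \<Rightarrow> ('a \<times> 'b \<times> 'c) mset_fun" where
  "massoc M = (\<lambda>(a, b, c). M ((a, b), c))"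

type_synonym 'c decomposition_rule = "'c \<Rightarrow> ('c \<times> 'c) mset_fun"


section \<open>Free vector spaces\<close>

text \<open>
  The space of finite linear combinations of elements of \<open>'a\<close> with coefficients in \<open>'k\<close> is
  \<open>'a \<Rightarrow>\<^sub>0 'k\<close>; the basis vector of \<open>a\<close> is \<open>Poly_Mapping.single a 1\<close>.
\<close>

definition fscale :: "'k::field \<Rightarrow> ('a \<Rightarrow>\<^sub>0 'k) \<Rightarrow> ('a \<Rightarrow>\<^sub>0 'k)" where
  "fscale c = Poly_Mapping.map ((*) c)"

abbreviation basis :: "'a \<Rightarrow> ('a \<Rightarrow>\<^sub>0 'k::field)" where
  "basis a \<equiv> Poly_Mapping.single a 1"

lemma lookup_fscale [simp]: "Poly_Mapping.lookup (fscale c v) a = c * Poly_Mapping.lookup v a"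
  by (auto simp: fscale_def map.rep_eq when_def)

lemma vector_space_fscale: "vector_space (fscale :: 'k::field \<Rightarrow> ('a \<Rightarrow>\<^sub>0 'k) \<Rightarrow> _)"
  by standard (rule poly_mapping_eqI, simp add: lookup_add algebra_simps)+

interpretation free: vector_space "fscale :: 'k::field \<Rightarrow> ('a \<Rightarrow>\<^sub>0 'k) \<Rightarrow> _"
  by (rule vector_space_fscale)

lemma free_expansion: "v = (\<Sum>a\<in>Poly_Mapping.keys v. fscale (Poly_Mapping.lookup v a) (basis a))"
proof (rule poly_mapping_eqI)
  fix i
  have "Poly_Mapping.lookup (\<Sum>a\<in>Poly_Mapping.keys v. fscale (Poly_Mapping.lookup v a) (basis a)) i
      = (\<Sum>a\<in>Poly_Mapping.keys v. if a = i then Poly_Mapping.lookup v a else 0)"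
    unfolding lookup_sum by (intro sum.cong refl) (simp add: lookup_single when_def)
  also have "\<dots> = Poly_Mapping.lookup v i"
    by (simp add: in_keys_iff)
  finally show "Poly_Mapping.lookup v i = Poly_Mapping.lookup (\<Sum>a\<in>Poly_Mapping.keys v. fscale (Poly_Mapping.lookup v a) (basis a)) i" by simp
qed

text \<open>
  Linear extension of a map given on the basis, with values in a vector space whose scalar
  multiplication is \<open>s\<close>.
\<close>

definition lin_ext :: "('k::field \<Rightarrow> 'w::ab_group_add \<Rightarrow> 'w) \<Rightarrow> ('a \<Rightarrow> 'w) \<Rightarrow> ('a \<Rightarrow>\<^sub>0 'k) \<Rightarrow> 'w" where
  "lin_ext s f v = (\<Sum>a\<in>Poly_Mapping.keys v. s (Poly_Mapping.lookup v a) (f a))"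

lemma lin_ext_superset:
  assumes "vector_space s" "finite A" "Poly_Mapping.keys v \<subseteq> A"
  shows "lin_ext s f v = (\<Sum>a\<in>A. s (Poly_Mapping.lookup v a) (f a))"
proof -
  interpret vector_space s by fact
  show ?thesis
    unfolding lin_ext_def using assms(2,3)
    by (intro sum.mono_neutral_left) (auto simp: in_keys_iff)
qed

lemma linear_lin_ext:
  assumes "vector_space s"
  shows "Vector_Spaces.linear fscale s (lin_ext s f)"
proof -
  interpret vector_space s by fact
  have add: "lin_ext s f (u + v) = lin_ext s f u + lin_ext s f v" for u v
  proof -
    let ?A = "Poly_Mapping.keys u \<union> Poly_Mapping.keys v"
    have "Poly_Mapping.keys (u + v) \<subseteq> ?A" by (rule Poly_Mapping.keys_add)
    then show ?thesis
      by (simp add: lin_ext_superset[OF assms, of ?A] lookup_add scale_left_distrib sum.distrib)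
  qed
  have sc: "lin_ext s f (fscale c v) = s c (lin_ext s f v)" for c v
  proof -
    have "Poly_Mapping.keys (fscale c v) \<subseteq> Poly_Mapping.keys v" by (auto simp: in_keys_iff)
    then show ?thesis
      by (simp add: lin_ext_superset[OF assms, of "Poly_Mapping.keys v"] scale_sum_right)
  qed
  show ?thesis by unfold_locales (simp_all add: add sc)
qed

lemma lin_ext_basis:
  assumes "vector_space s"
  shows "lin_ext s f (basis a) = f a"
proof -
  interpret vector_space s by fact
  show ?thesis by (simp add: lin_ext_def)
qed

lemma lin_ext_unique:
  assumes "Vector_Spaces.linear fscale s g"
  shows "g = lin_ext s (\<lambda>a. g (basis a))"
proof
  fix v
  interpret Vector_Spaces.linear fscale s g by fact
  have "g v = g (\<Sum>a\<in>Poly_Mapping.keys v. fscale (Poly_Mapping.lookup v a) (basis a))"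
    using free_expansion[of v] by simp
  also have "\<dots> = lin_ext s (\<lambda>a. g (basis a)) v"
    by (simp add: lin_ext_def sum scale)
  finally show "g v = lin_ext s (\<lambda>a. g (basis a)) v" .
qed


section \<open>Tensor products of free vector spaces\<close>

text \<open>
  The tensor product of the free vector spaces on \<open>'a\<close> and \<open>'b\<close> is realised as the free vector
  space on \<open>'a \<times> 'b\<close>; \<open>tensor_universal\<close> below is its universal property.  All maps out of a
  tensor product are defined through \<open>tensor_lift\<close>, that is, by that property.
\<close>

definition tensor :: "('a \<Rightarrow>\<^sub>0 'k::field) \<Rightarrow> ('b \<Rightarrow>\<^sub>0 'k) \<Rightarrow> ('a \<times> 'b \<Rightarrow>\<^sub>0 'k)" (infixr "\<otimes>" 75) where
  "u \<otimes> v = (\<Sum>a\<in>Poly_Mapping.keys u. \<Sum>b\<in>Poly_Mapping.keys v. fscale (Poly_Mapping.lookup u a * Poly_Mapping.lookup v b) (basis (a, b)))"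

definition bilinear_map ::
  "('k::field \<Rightarrow> 'w::ab_group_add \<Rightarrow> 'w) \<Rightarrow> (('a \<Rightarrow>\<^sub>0 'k) \<Rightarrow> ('b \<Rightarrow>\<^sub>0 'k) \<Rightarrow> 'w) \<Rightarrow> bool" where
  "bilinear_map s h \<longleftrightarrow>
     (\<forall>u. Vector_Spaces.linear fscale s (\<lambda>v. h u v)) \<and>
     (\<forall>v. Vector_Spaces.linear fscale s (\<lambda>u. h u v))"

text \<open>The linear map on the tensor product induced by a bilinear map \<open>h\<close>.\<close>

definition tensor_lift ::
  "('k::field \<Rightarrow> 'w::ab_group_add \<Rightarrow> 'w) \<Rightarrow> (('a \<Rightarrow>\<^sub>0 'k) \<Rightarrow> ('b \<Rightarrow>\<^sub>0 'k) \<Rightarrow> 'w)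
    \<Rightarrow> ('a \<times> 'b \<Rightarrow>\<^sub>0 'k) \<Rightarrow> 'w" where
  "tensor_lift s h = lin_ext s (\<lambda>(a, b). h (basis a) (basis b))"

lemma lookup_tensor:
  "Poly_Mapping.lookup (u \<otimes> v) (a, b) = Poly_Mapping.lookup u a * Poly_Mapping.lookup v b"
proof -
  have "Poly_Mapping.lookup (u \<otimes> v) (a, b) =
      (\<Sum>a'\<in>Poly_Mapping.keys u. \<Sum>b'\<in>Poly_Mapping.keys v.
        (if a' = a then Poly_Mapping.lookup u a' else 0) *
        (if b' = b then Poly_Mapping.lookup v b' else 0))"
    unfolding tensor_def lookup_sum
    by (intro sum.cong refl) (simp add: lookup_single when_def)
  also have "\<dots> = (\<Sum>a'\<in>Poly_Mapping.keys u. if a' = a then Poly_Mapping.lookup u a' else 0) *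
      (\<Sum>b'\<in>Poly_Mapping.keys v. if b' = b then Poly_Mapping.lookup v b' else 0)"
    by (rule sum_product[symmetric])
  also have "\<dots> = Poly_Mapping.lookup u a * Poly_Mapping.lookup v b"
    by (simp add: in_keys_iff)
  finally show ?thesis .
qed

lemma tensor_basis: "basis a \<otimes> basis b = basis (a, b)"
  by (rule poly_mapping_eqI) (auto simp: lookup_tensor lookup_single when_def split: prod.splits if_splits)

lemma bilinear_tensor: "bilinear_map fscale (\<otimes>)"
  unfolding bilinear_map_def
  by (intro conjI allI; unfold_locales;
      rule poly_mapping_eqI; clarsimp simp: lookup_tensor lookup_add algebra_simps)

lemma linear_tensor_lift:
  "vector_space s \<Longrightarrow> Vector_Spaces.linear fscale s (tensor_lift s h)"
  unfolding tensor_lift_def by (rule linear_lin_ext)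

lemma tensor_lift_tensor:
  assumes "bilinear_map s h"
  shows "tensor_lift s h (u \<otimes> v) = h u v"
proof -
  have vs: "vector_space s"
    using assms unfolding bilinear_map_def Vector_Spaces.linear_def by blast
  interpret W: vector_space s by (rule vs)
  interpret L: Vector_Spaces.linear fscale s "\<lambda>u. h u w" for w
    using assms by (simp add: bilinear_map_def)
  interpret R: Vector_Spaces.linear fscale s "\<lambda>v. h w v" for w
    using assms by (simp add: bilinear_map_def)
  have vs: "vector_space s" by unfold_locales
  interpret T: Vector_Spaces.linear fscale s "tensor_lift s h"
    by (rule linear_tensor_lift[OF vs])
  have "tensor_lift s h (u \<otimes> v) =
      (\<Sum>a\<in>Poly_Mapping.keys u. \<Sum>b\<in>Poly_Mapping.keys v. s (Poly_Mapping.lookup u a * Poly_Mapping.lookup v b) (tensor_lift s h (basis (a, b))))"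
    by (simp add: tensor_def T.sum T.scale)
  also have "\<dots> = (\<Sum>a\<in>Poly_Mapping.keys u. s (Poly_Mapping.lookup u a) (\<Sum>b\<in>Poly_Mapping.keys v. s (Poly_Mapping.lookup v b) (h (basis a) (basis b))))"
    by (simp add: tensor_lift_def lin_ext_basis[OF vs] W.scale_sum_right)
  also have "\<dots> = (\<Sum>a\<in>Poly_Mapping.keys u. s (Poly_Mapping.lookup u a) (h (basis a) v))"
  proof (rule sum.cong[OF refl])
    fix a
    have "h (basis a) v = h (basis a) (\<Sum>b\<in>Poly_Mapping.keys v. fscale (Poly_Mapping.lookup v b) (basis b))"
      using free_expansion[of v] by simp
    then show "s (Poly_Mapping.lookup u a) (\<Sum>b\<in>Poly_Mapping.keys v. s (Poly_Mapping.lookup v b) (h (basis a) (basis b)))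
        = s (Poly_Mapping.lookup u a) (h (basis a) v)"
      by (simp add: R.sum R.scale)
  qed
  also have "\<dots> = h (\<Sum>a\<in>Poly_Mapping.keys u. fscale (Poly_Mapping.lookup u a) (basis a)) v"
    by (simp add: L.sum L.scale)
  also have "\<dots> = h u v"
    using free_expansion[of u] by simp
  finally show ?thesis .
qed

lemma tensor_universal:
  assumes "bilinear_map s h"
  shows "\<exists>!g. Vector_Spaces.linear fscale s g \<and> (\<forall>u v. g (u \<otimes> v) = h u v)"
proof (rule ex1I[of _ "tensor_lift s h"])
  have vs: "vector_space s"
    using assms unfolding bilinear_map_def Vector_Spaces.linear_def by blast
  show "Vector_Spaces.linear fscale s (tensor_lift s h) \<and> (\<forall>u v. tensor_lift s h (u \<otimes> v) = h u v)"
    using linear_tensor_lift[OF vs] tensor_lift_tensor[OF assms] by blast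
next
  fix g
  assume g: "Vector_Spaces.linear fscale s g \<and> (\<forall>u v. g (u \<otimes> v) = h u v)"
  then have "g = lin_ext s (\<lambda>p. g (basis p))"
    by (intro lin_ext_unique) blast
  also have "(\<lambda>p. g (basis p)) = (\<lambda>(a, b). h (basis a) (basis b))"
    using g by (auto simp: fun_eq_iff tensor_basis[symmetric])
  finally show "g = tensor_lift s h"
    by (simp add: tensor_lift_def)
qed

definition tensor_map ::
  "(('a \<Rightarrow>\<^sub>0 'k::field) \<Rightarrow> ('c \<Rightarrow>\<^sub>0 'k)) \<Rightarrow> (('b \<Rightarrow>\<^sub>0 'k) \<Rightarrow> ('d \<Rightarrow>\<^sub>0 'k))
    \<Rightarrow> ('a \<times> 'b \<Rightarrow>\<^sub>0 'k) \<Rightarrow> ('c \<times> 'd \<Rightarrow>\<^sub>0 'k)" where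
  "tensor_map f g = tensor_lift fscale (\<lambda>u v. f u \<otimes> g v)"

definition tensor_assoc :: "(('a \<times> 'b) \<times> 'c \<Rightarrow>\<^sub>0 'k::field) \<Rightarrow> ('a \<times> 'b \<times> 'c \<Rightarrow>\<^sub>0 'k)" where
  "tensor_assoc =
     tensor_lift fscale (\<lambda>t w. tensor_lift fscale (\<lambda>u v. u \<otimes> (v \<otimes> w)) t)"

definition tensor_swap :: "('a \<times> 'b \<Rightarrow>\<^sub>0 'k::field) \<Rightarrow> ('b \<times> 'a \<Rightarrow>\<^sub>0 'k)" where
  "tensor_swap = tensor_lift fscale (\<lambda>u v. v \<otimes> u)"

text \<open>
  For a linear form \<open>e\<close>, the maps $e \otimes \mathrm{id}$ and $\mathrm{id} \otimes e$ followed by the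
  canonical isomorphisms of $K \otimes V$ and $V \otimes K$ with $V$.
\<close>

definition contract_left :: "(('a \<Rightarrow>\<^sub>0 'k::field) \<Rightarrow> 'k) \<Rightarrow> ('a \<times> 'b \<Rightarrow>\<^sub>0 'k) \<Rightarrow> ('b \<Rightarrow>\<^sub>0 'k)" where
  "contract_left e = tensor_lift fscale (\<lambda>u v. fscale (e u) v)"

definition contract_right :: "(('b \<Rightarrow>\<^sub>0 'k::field) \<Rightarrow> 'k) \<Rightarrow> ('a \<times> 'b \<Rightarrow>\<^sub>0 'k) \<Rightarrow> ('a \<Rightarrow>\<^sub>0 'k)" where
  "contract_right e = tensor_lift fscale (\<lambda>u v. fscale (e v) u)"


section \<open>Co-algebras\<close>

definition coassociative :: "(('a \<Rightarrow>\<^sub>0 'k::field) \<Rightarrow> ('a \<times> 'a \<Rightarrow>\<^sub>0 'k)) \<Rightarrow> bool" where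
  "coassociative D \<longleftrightarrow> tensor_assoc \<circ> tensor_map D id \<circ> D = tensor_map id D \<circ> D"

definition counital ::
  "(('a \<Rightarrow>\<^sub>0 'k::field) \<Rightarrow> ('a \<times> 'a \<Rightarrow>\<^sub>0 'k)) \<Rightarrow> (('a \<Rightarrow>\<^sub>0 'k) \<Rightarrow> 'k) \<Rightarrow> bool" where
  "counital D e \<longleftrightarrow> contract_left e \<circ> D = id \<and> contract_right e \<circ> D = id"

definition coalgebra ::
  "(('a \<Rightarrow>\<^sub>0 'k::field) \<Rightarrow> ('a \<times> 'a \<Rightarrow>\<^sub>0 'k)) \<Rightarrow> (('a \<Rightarrow>\<^sub>0 'k) \<Rightarrow> 'k) \<Rightarrow> bool" where
  "coalgebra D e \<longleftrightarrow>
     Vector_Spaces.linear fscale fscale D \<and> Vector_Spaces.linear fscale (*) e \<and>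
     coassociative D \<and> counital D e"

definition cocommutative :: "(('a \<Rightarrow>\<^sub>0 'k::field) \<Rightarrow> ('a \<times> 'a \<Rightarrow>\<^sub>0 'k)) \<Rightarrow> bool" where
  "cocommutative D \<longleftrightarrow> tensor_swap \<circ> D = D"


section \<open>The co-multiplication and co-unit of a decomposition rule\<close>

definition comult :: "'c decomposition_rule \<Rightarrow> ('c \<Rightarrow>\<^sub>0 'k::field) \<Rightarrow> ('c \<times> 'c \<Rightarrow>\<^sub>0 'k)" where
  "comult dec = lin_ext fscale (\<lambda>\<Gamma>. \<Sum>(\<Gamma>'', \<Gamma>')\<in>msupport (dec \<Gamma>).
     fscale (of_nat (dec \<Gamma> (\<Gamma>'', \<Gamma>'))) (basis \<Gamma>'' \<otimes> basis \<Gamma>'))"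

definition counit :: "'c \<Rightarrow> ('c \<Rightarrow>\<^sub>0 'k::field) \<Rightarrow> 'k" where
  "counit void = lin_ext (*) (\<lambda>\<Gamma>. if \<Gamma> = void then 1 else 0)"

end

theory Submission
  imports Defs
begin

text \<open>
  A finite multiset \<open>M\<close> has a generating vector, the sum of its elements counted with multiplicity
  (\<open>mset_vec M\<close>), and \<open>\<Delta>(\<Gamma>)\<close> is the generating vector of \<open>\<langle>\<Gamma>\<rangle>\<close>.  Passing to generating vectors
  turns the operations on multisets into linear algebra: sums over an index multiset become linear
  combinations (\<open>mset_vec_msum\<close>), products become tensor products (\<open>mset_vec_mtimes\<close>), and
  regrouping or exchanging components becomes the associator or the flip of the tensor product
  (\<open>linear_mset_vec_bij\<close>).  Under this dictionary the two sides of the triple decomposition are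
  \<open>(id \<otimes> \<Delta>)(\<Delta>(\<Gamma>))\<close> and, up to the associator, \<open>(\<Delta> \<otimes> id)(\<Delta>(\<Gamma>))\<close>, which gives
  co-associativity on the basis, hence everywhere by linearity; symmetry of \<open>\<langle>\<Gamma>\<rangle>\<close> says in the same
  way that the flip fixes \<open>\<Delta>(\<Gamma>)\<close>.  Only equalities of multisets are transported, so the fact that
  multiplicities may vanish in a field of positive characteristic does no harm.

  For the co-unit, \<open>\<epsilon> \<otimes> id\<close> retains from \<open>\<Delta>(\<Gamma>)\<close> the terms whose first component is the void
  object, and the void axiom leaves precisely \<open>(void, \<Gamma>)\<close>, once;
  \<open>id \<otimes> \<epsilon>\<close> is symmetric.
\<close>

section \<open>Generating vectors of multisets\<close>

definition mset_vec :: "'a mset_fun \<Rightarrow> ('a \<Rightarrow>\<^sub>0 'k::field)" where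
  "mset_vec M = (\<Sum>x\<in>msupport M. fscale (of_nat (M x)) (basis x))"

lemma lookup_mset_vec:
  assumes "mfinite M"
  shows "Poly_Mapping.lookup (mset_vec M) x = of_nat (M x)"
proof -
  have "Poly_Mapping.lookup (mset_vec M :: 'a \<Rightarrow>\<^sub>0 'b) x
      = (\<Sum>y\<in>msupport M. if y = x then of_nat (M y) else 0)"
    unfolding mset_vec_def lookup_sum by (intro sum.cong refl) (simp add: lookup_single when_def)
  also have "\<dots> = of_nat (M x)"
    using assms by (simp add: mfinite_def) (simp add: msupport_def)
  finally show ?thesis .
qed

lemma mfinite_msingleton: "mfinite (msingleton x)"
  by (simp add: mfinite_def msupport_def msingleton_def)

lemma mset_vec_msingleton: "mset_vec (msingleton x) = basis x"
  by (rule poly_mapping_eqI)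
    (simp add: lookup_mset_vec mfinite_msingleton, simp add: msingleton_def lookup_single when_def)

lemma mfinite_mtimes:
  assumes "mfinite M" "mfinite N"
  shows "mfinite (mtimes M N)"
proof -
  have "msupport (mtimes M N) = msupport M \<times> msupport N"
    by (auto simp: msupport_def mtimes_def)
  then show ?thesis using assms by (simp add: mfinite_def)
qed

lemma mset_vec_mtimes:
  assumes "mfinite M" "mfinite N"
  shows "mset_vec (mtimes M N) = mset_vec M \<otimes> mset_vec N"
  by (rule poly_mapping_eqI)
    (clarsimp simp: lookup_mset_vec assms mfinite_mtimes lookup_tensor, simp add: mtimes_def)

lemma mset_vec_msum:
  assumes I: "mfinite I" and F: "\<And>i. mfinite (F i)"
  shows "mset_vec (msum I F) = (\<Sum>i\<in>msupport I. fscale (of_nat (I i)) (mset_vec (F i)))"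
proof -
  have "msupport (msum I F) \<subseteq> (\<Union>i\<in>msupport I. msupport (F i))"
  proof
    fix x assume "x \<in> msupport (msum I F)"
    then have "(\<Sum>i\<in>msupport I. I i * F i x) \<noteq> 0" by (simp add: msupport_def msum_def)
    then obtain i where "i \<in> msupport I" "I i * F i x \<noteq> 0"
      by (rule sum.not_neutral_contains_not_neutral)
    then show "x \<in> (\<Union>i\<in>msupport I. msupport (F i))" by (auto simp: msupport_def)
  qed
  then have "mfinite (msum I F)"
    using I F unfolding mfinite_def by (rule_tac finite_subset) auto
  then show ?thesis
    by (intro poly_mapping_eqI) (simp add: lookup_mset_vec F lookup_sum, simp add: msum_def)
qed

lemma linear_mset_vec:
  assumes "Vector_Spaces.linear fscale s L"
  shows "L (mset_vec M) = (\<Sum>x\<in>msupport M. s (of_nat (M x)) (L (basis x)))"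
proof -
  interpret Vector_Spaces.linear fscale s L by fact
  show ?thesis by (simp add: mset_vec_def sum scale)
qed

text \<open>
  A linear map that permutes basis vectors acts on generating vectors by relabelling.  This covers
  the associator, the flip and, with them, the identifications made between multisets of tuples.
\<close>

lemma linear_mset_vec_bij:
  assumes L: "Vector_Spaces.linear fscale fscale L" "\<And>x. L (basis x) = basis (f x)"
    and f: "bij f" "\<And>x. N (f x) = M x"
  shows "L (mset_vec M) = mset_vec N"
proof -
  have "bij_betw f (msupport M) (msupport N)"
    unfolding bij_betw_def
  proof
    show "inj_on f (msupport M)" using f(1) by (auto simp: bij_def inj_on_def)
    show "f ` msupport M = msupport N"
    proof
      show "f ` msupport M \<subseteq> msupport N" by (auto simp: msupport_def f(2))
      show "msupport N \<subseteq> f ` msupport M"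
      proof
        fix y assume "y \<in> msupport N"
        moreover obtain x where "y = f x" using f(1) by (metis bij_pointE)
        ultimately show "y \<in> f ` msupport M" by (auto simp: msupport_def f(2))
      qed
    qed
  qed
  then have "(\<Sum>x\<in>msupport M. fscale (of_nat (N (f x))) (basis (f x))) = mset_vec N"
    unfolding mset_vec_def by (rule sum.reindex_bij_betw)
  then show ?thesis unfolding linear_mset_vec[OF L(1)] L(2) f(2) .
qed

section \<open>Linear maps out of tensor products, on basis vectors\<close>

lemma linear_eq_on_basis:
  assumes "Vector_Spaces.linear fscale s f" "Vector_Spaces.linear fscale s g"
    and "\<And>a. f (basis a) = g (basis a)"
  shows "f = g"
  using lin_ext_unique[OF assms(1)] lin_ext_unique[OF assms(2)] assms(3) by simp

lemma linear_fscale_compose: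
  "Vector_Spaces.linear fscale fscale f \<Longrightarrow> Vector_Spaces.linear fscale fscale g \<Longrightarrow>
    Vector_Spaces.linear fscale fscale (g \<circ> f)"
  by (rule Vector_Spaces.linear_compose)

lemma tensor_lift_basis:
  "vector_space s \<Longrightarrow> tensor_lift s h (basis (a, b)) = h (basis a) (basis b)"
  by (simp add: tensor_lift_def lin_ext_basis)

lemma linear_fscale_tensor_lift: "Vector_Spaces.linear fscale fscale (tensor_lift fscale h)"
  by (rule linear_tensor_lift) (rule vector_space_fscale)

lemma linear_tensor_map: "Vector_Spaces.linear fscale fscale (tensor_map f g)"
  unfolding tensor_map_def by (rule linear_fscale_tensor_lift)

lemma tensor_map_basis: "tensor_map f g (basis (a, b)) = f (basis a) \<otimes> g (basis b)"
  unfolding tensor_map_def by (rule tensor_lift_basis[OF vector_space_fscale])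

lemma tensor_assoc_mset_vec: "tensor_assoc (mset_vec M) = mset_vec (massoc M)"
proof (rule linear_mset_vec_bij)
  show "Vector_Spaces.linear fscale fscale tensor_assoc"
    unfolding tensor_assoc_def by (rule linear_fscale_tensor_lift)
  show "tensor_assoc (basis x) = basis ((\<lambda>((a, b), c). (a, b, c)) x)" for x :: "('a \<times> 'b) \<times> 'c"
    by (cases x) (auto simp: tensor_assoc_def tensor_lift_basis vector_space_fscale tensor_basis)
  show "bij (\<lambda>((a, b), c). (a, b, c))"
    by (rule bij_betw_byWitness[where f' = "\<lambda>(a, b, c). ((a, b), c)"]) auto
qed (auto simp: massoc_def)

lemma tensor_swap_mset_vec:
  assumes "\<And>a b. N (b, a) = M (a, b)"
  shows "tensor_swap (mset_vec M) = mset_vec N"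
proof (rule linear_mset_vec_bij)
  show "Vector_Spaces.linear fscale fscale tensor_swap"
    unfolding tensor_swap_def by (rule linear_fscale_tensor_lift)
  show "tensor_swap (basis x) = basis (prod.swap x)" for x :: "'a \<times> 'b"
    by (cases x) (simp add: tensor_swap_def tensor_lift_basis vector_space_fscale tensor_basis)
  show "bij (prod.swap :: 'a \<times> 'b \<Rightarrow> _)" by simp
qed (auto simp: assms)

section \<open>Co-multiplication and co-unit\<close>

lemma linear_comult: "Vector_Spaces.linear fscale fscale (comult dec)"
  unfolding comult_def by (rule linear_lin_ext) (rule vector_space_fscale)

lemma comult_basis: "comult dec (basis \<Gamma>) = mset_vec (dec \<Gamma>)"
  by (simp add: comult_def lin_ext_basis[OF vector_space_fscale] mset_vec_def tensor_basis
      case_prod_unfold)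

lemma vector_space_field: "vector_space ((*) :: 'k::field \<Rightarrow> 'k \<Rightarrow> 'k)"
  by standard (simp_all add: algebra_simps)

lemma linear_counit: "Vector_Spaces.linear fscale (*) (counit void)"
  unfolding counit_def by (rule linear_lin_ext) (rule vector_space_field)

lemma counit_basis: "counit void (basis \<Gamma>) = (if \<Gamma> = void then 1 else 0)"
  unfolding counit_def by (rule lin_ext_basis) (rule vector_space_field)

text \<open>
  Splitting the first or the second component of every pair in \<open>\<langle>\<Gamma>\<rangle>\<close> yields, as generating
  vectors, \<open>(\<Delta> \<otimes> id)(\<Delta>(\<Gamma>))\<close> and \<open>(id \<otimes> \<Delta>)(\<Delta>(\<Gamma>))\<close>; the associator then acts on the former as
  the regrouping of triples does on multisets.
\<close>

lemma coassociative_comult: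
  assumes fin: "\<And>\<Gamma>. mfinite (dec \<Gamma>)"
    and triple: "\<And>\<Gamma>. msum (dec \<Gamma>) (\<lambda>(\<Gamma>'', \<Gamma>'). mtimes (msingleton \<Gamma>'') (dec \<Gamma>'))
                    = massoc (msum (dec \<Gamma>) (\<lambda>(\<Gamma>'', \<Gamma>'). mtimes (dec \<Gamma>'') (msingleton \<Gamma>')))"
  shows "coassociative (comult dec :: ('c \<Rightarrow>\<^sub>0 'k::field) \<Rightarrow> _)"
  unfolding coassociative_def
proof (rule linear_eq_on_basis)
  let ?D = "comult dec :: ('c \<Rightarrow>\<^sub>0 'k) \<Rightarrow> _"
  show "Vector_Spaces.linear fscale fscale (tensor_assoc \<circ> tensor_map ?D id \<circ> ?D)"
    unfolding tensor_assoc_def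
    by (intro linear_fscale_compose linear_fscale_tensor_lift linear_tensor_map linear_comult)
  show "Vector_Spaces.linear fscale fscale (tensor_map id ?D \<circ> ?D)"
    by (intro linear_fscale_compose linear_tensor_map linear_comult)
  fix \<Gamma>
  have "tensor_map ?D id (?D (basis \<Gamma>))
      = mset_vec (msum (dec \<Gamma>) (\<lambda>(\<Gamma>'', \<Gamma>'). mtimes (dec \<Gamma>'') (msingleton \<Gamma>')))"
    by (subst mset_vec_msum)
      (auto simp: comult_basis linear_mset_vec[OF linear_tensor_map] tensor_map_basis fin
        mset_vec_mtimes mset_vec_msingleton mfinite_mtimes mfinite_msingleton
        split: prod.split intro!: sum.cong)
  moreover have "tensor_map id ?D (?D (basis \<Gamma>))
      = mset_vec (msum (dec \<Gamma>) (\<lambda>(\<Gamma>'', \<Gamma>'). mtimes (msingleton \<Gamma>'') (dec \<Gamma>')))"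
    by (subst mset_vec_msum)
      (auto simp: comult_basis linear_mset_vec[OF linear_tensor_map] tensor_map_basis fin
        mset_vec_mtimes mset_vec_msingleton mfinite_mtimes mfinite_msingleton
        split: prod.split intro!: sum.cong)
  ultimately show "(tensor_assoc \<circ> tensor_map ?D id \<circ> ?D) (basis \<Gamma>) = (tensor_map id ?D \<circ> ?D) (basis \<Gamma>)"
    by (simp add: tensor_assoc_mset_vec triple)
qed

lemma contract_left_counit_mset_vec:
  assumes fin: "mfinite M" and M: "\<And>b. M (void, b) = (if b = c then 1 else 0)"
  shows "contract_left (counit void) (mset_vec M) = basis c"
proof -
  have "contract_left (counit void) (mset_vec M) = (\<Sum>p\<in>msupport M. fscale (of_nat (M p))
      (fscale (if fst p = void then 1 else 0) (basis (snd p))))"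
    unfolding contract_left_def
    unfolding linear_mset_vec[OF linear_fscale_tensor_lift]
    by (intro sum.cong refl)
      (simp add: split_paired_all tensor_lift_basis vector_space_fscale counit_basis)
  also have "\<dots> = (\<Sum>p\<in>msupport M. if p = (void, c) then basis c else 0)"
    using M by (intro sum.cong refl) (auto simp: msupport_def split: if_splits)
  also have "\<dots> = basis c"
    using fin M by (simp add: mfinite_def) (simp add: msupport_def)
  finally show ?thesis .
qed

lemma contract_right_counit_mset_vec:
  assumes fin: "mfinite M" and M: "\<And>a. M (a, void) = (if a = c then 1 else 0)"
  shows "contract_right (counit void) (mset_vec M) = basis c"
proof -
  have "contract_right (counit void) (mset_vec M) = (\<Sum>p\<in>msupport M. fscale (of_nat (M p))
      (fscale (if snd p = void then 1 else 0) (basis (fst p))))"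
    unfolding contract_right_def
    unfolding linear_mset_vec[OF linear_fscale_tensor_lift]
    by (intro sum.cong refl)
      (simp add: split_paired_all tensor_lift_basis vector_space_fscale counit_basis)
  also have "\<dots> = (\<Sum>p\<in>msupport M. if p = (c, void) then basis c else 0)"
    using M by (intro sum.cong refl) (auto simp: msupport_def split: if_splits)
  also have "\<dots> = basis c"
    using fin M by (simp add: mfinite_def) (simp add: msupport_def)
  finally show ?thesis .
qed

lemma counital_comult:
  assumes fin: "\<And>\<Gamma>. mfinite (dec \<Gamma>)"
    and left: "\<And>\<Gamma> b. dec \<Gamma> (void, b) = (if b = \<Gamma> then 1 else 0)"
    and right: "\<And>\<Gamma> a. dec \<Gamma> (a, void) = (if a = \<Gamma> then 1 else 0)"
  shows "counital (comult dec) (counit void)"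
  unfolding counital_def
proof
  show "contract_left (counit void) \<circ> comult dec = id"
  proof (rule linear_eq_on_basis)
    show "Vector_Spaces.linear fscale fscale (contract_left (counit void) \<circ> comult dec)"
      unfolding contract_left_def
      by (intro linear_fscale_compose linear_fscale_tensor_lift linear_comult)
  qed (simp_all add: free.linear_id comult_basis contract_left_counit_mset_vec fin left)
  show "contract_right (counit void) \<circ> comult dec = id"
  proof (rule linear_eq_on_basis)
    show "Vector_Spaces.linear fscale fscale (contract_right (counit void) \<circ> comult dec)"
      unfolding contract_right_def
      by (intro linear_fscale_compose linear_fscale_tensor_lift linear_comult)
  qed (simp_all add: free.linear_id comult_basis contract_right_counit_mset_vec fin right)
qed

lemma cocommutative_comult:
  assumes "\<And>\<Gamma> a b. dec \<Gamma> (a, b) = dec \<Gamma> (b, a)"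
  shows "cocommutative (comult dec)"
  unfolding cocommutative_def
proof (rule linear_eq_on_basis)
  show "Vector_Spaces.linear fscale fscale (tensor_swap \<circ> comult dec)"
    unfolding tensor_swap_def
    by (intro linear_fscale_compose linear_fscale_tensor_lift linear_comult)
  show "Vector_Spaces.linear fscale fscale (comult dec)" by (rule linear_comult)
  show "(tensor_swap \<circ> comult dec) (basis \<Gamma>) = comult dec (basis \<Gamma>)" for \<Gamma>
    using assms by (simp add: comult_basis tensor_swap_mset_vec)
qed

theorem proposition2:
  fixes dec :: "'c::countable decomposition_rule"
    and void :: 'c
  assumes finiteness: "\<And>\<Gamma>. mfinite (dec \<Gamma>)"
    and triple: "\<And>\<Gamma>. msum (dec \<Gamma>) (\<lambda>(\<Gamma>'', \<Gamma>'). mtimes (msingleton \<Gamma>'') (dec \<Gamma>'))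
                    = massoc (msum (dec \<Gamma>) (\<lambda>(\<Gamma>'', \<Gamma>'). mtimes (dec \<Gamma>'') (msingleton \<Gamma>')))"
    and void_dec: "dec void = msingleton (void, void)"
    and void_comp: "\<And>\<Gamma> \<Gamma>'' \<Gamma>'. \<Gamma> \<noteq> void \<Longrightarrow>
          \<Gamma>'' = void \<or> \<Gamma>'' = \<Gamma> \<or> \<Gamma>' = void \<or> \<Gamma>' = \<Gamma> \<Longrightarrow>
          dec \<Gamma> (\<Gamma>'', \<Gamma>') =
            (if (\<Gamma>'', \<Gamma>') = (void, \<Gamma>) \<or> (\<Gamma>'', \<Gamma>') = (\<Gamma>, void) then 1 else 0)"
  shows "coalgebra (comult dec :: ('c \<Rightarrow>\<^sub>0 'k::field) \<Rightarrow> ('c \<times> 'c \<Rightarrow>\<^sub>0 'k)) (counit void)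
       \<and> ((\<forall>\<Gamma> \<Gamma>' \<Gamma>''. dec \<Gamma> (\<Gamma>', \<Gamma>'') = dec \<Gamma> (\<Gamma>'', \<Gamma>'))
            \<longrightarrow> cocommutative (comult dec :: ('c \<Rightarrow>\<^sub>0 'k) \<Rightarrow> ('c \<times> 'c \<Rightarrow>\<^sub>0 'k)))"
proof
  \<comment> \<open>Pairs with a void component are all that the co-unit sees of \<open>\<langle>\<Gamma>\<rangle>\<close>, and they obey one rule,
     whether \<open>\<Gamma>\<close> is void or not.\<close>
  have left: "dec \<Gamma> (void, b) = (if b = \<Gamma> then 1 else 0)" for \<Gamma> b
    by (cases "\<Gamma> = void") (auto simp: void_dec msingleton_def void_comp)
  have right: "dec \<Gamma> (a, void) = (if a = \<Gamma> then 1 else 0)" for \<Gamma> a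
    by (cases "\<Gamma> = void") (auto simp: void_dec msingleton_def void_comp)
  show "coalgebra (comult dec :: ('c \<Rightarrow>\<^sub>0 'k) \<Rightarrow> _) (counit void)"
    unfolding coalgebra_def
    by (intro conjI linear_comult linear_counit coassociative_comult counital_comult finiteness triple
        left right)
  show "(\<forall>\<Gamma> \<Gamma>' \<Gamma>''. dec \<Gamma> (\<Gamma>', \<Gamma>'') = dec \<Gamma> (\<Gamma>'', \<Gamma>'))
      \<longrightarrow> cocommutative (comult dec :: ('c \<Rightarrow>\<^sub>0 'k) \<Rightarrow> _)"
    by (intro impI cocommutative_comult) blast
qed

end
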